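(* Let $S$ be a $\mathrm{Cu}$-semigroup, and let $x\in S$. Then: (a) If $x$ is strongly soft, then $x$ is weakly soft. (b) If $x$ is weakly soft, then $x$ is functionally soft and $x$ is purely noncompact. (c) If $x$ is purely noncompact or functionally soft, then $x$ is weakly purely noncompact. (d) If $S$ satisfies (O5), then $x$ is functionally soft if and only if $x$ is weakly purely noncompact. (e) If $S$ satisfies (O5) and is residually stably finite, then the properties of $x$ being strongly soft, weakly soft, functionally soft, purely noncompact, and weakly purely noncompact are all equivalent.
   Context: In a partially ordered set in which suprema of increasing sequences exist, $x\ll y$ means that for every increasing sequence $(z_n)_n$ with $y\leq\sup_nz_n$ there is $n$ with $x\leq z_n$. A $\mathrm{Cu}$-semigroup is a commutative monoid $S$ with a translation-invariant partial order in which $0\leq x$ for all $x$, such that: (O1) every increasing sequence has a supremum; (O2) every element is the supremum of a sequence $(x_n)_n$ with $x_n\ll x_{n+1}$ for all $n$; (O3) $x'\ll x$ and $y'\ll y$ imply $x'+y'\ll x+y$; (O4) $\sup_n(x_n+y_n)=\sup_nx_n+\sup_ny_n$ for increasing sequences. We write $\infty y:=\sup_nny$. An element $x$ is compact if $x\ll x$. (O5): given $x',x,y',y,z\in S$ with $x'\ll x$, $y'\ll y$ and $x+y\leq z$, there is $c\in S$ with $x'+c\leq z\leq x+c$ and $y'\ll c$. An ideal $I\subseteq S$ is a submonoid that is downward-hereditary and closed under suprema of increasing sequences. The quotient $S/I$ is obtained from the preorder $x\leq_Iy$ iff $x\leq y+z$ for some $z\in I$, by identifying $x$ and $y$ when $x\leq_Iy\leq_Ix$;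 it is again a $\mathrm{Cu}$-semigroup. The image of $x$ in $S/I$ is denoted $x_I$. - $x$ is strongly soft if for every $x'\in S$ with $x'\ll x$ there is $t\in S$ with $x'+t\ll x$ and $x'\ll\infty t$. - $x$ is weakly soft if for every $x'\in S$ with $x'\ll x$ there are $n\geq1$ and $t_1,\ldots,t_n\in S$ with $x'+t_j\ll x$ for $j=1,\ldots,n$ and $x'\ll t_1+\cdots+t_n$. - $x$ is functionally soft if for every $x'\in S$ with $x'\ll x$ there is $n\geq1$ with $(n+1)x'\ll nx$. - $x$ is purely noncompact if for every ideal $I\subseteq S$ such that $x_I$ is compact in $S/I$, we have $2x_I=x_I$. - $x$ is weakly purely noncompact if for every ideal $I\subseteq S$ such that $x_I$ is compact in $S/I$, there is $n\in\mathbb{N}$ with $(n+1)x_I=nx_I$. $S$ is stably finite if for all $x,y\in S$ with $x+y\ll x$ we have $y=0$; $S$ is residually stably finite if every quotient $S/I$ by an ideal is stably finite. *)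

theory Defs
  imports "HOL-Algebra.FiniteProduct"
begin

text \<open>
  An ordered monoid is a monoid record of HOL-Algebra with an additional relation.  The monoid is
  written additively, so the library's product, unit and natural powers are displayed as sum, zero
  and natural multiples.
\<close>

record 'a ordered_monoid = "'a monoid" +
  leq :: "['a, 'a] \<Rightarrow> bool" (infix "\<preceq>\<index>" 50)

abbreviation add_op :: "[('a, 'b) ordered_monoid_scheme, 'a, 'a] \<Rightarrow> 'a" (infixl "\<^bold>+\<index>" 65)
  where "x \<^bold>+\<^bsub>S\<^esub> y \<equiv> x \<otimes>\<^bsub>S\<^esub> y"

abbreviation zero_elt :: "('a, 'b) ordered_monoid_scheme \<Rightarrow> 'a" ("\<^bold>0\<index>")
  where "\<^bold>0\<^bsub>S\<^esub> \<equiv> \<one>\<^bsub>S\<^esub>"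

abbreviation nat_mult :: "[('a, 'b) ordered_monoid_scheme, nat, 'a] \<Rightarrow> 'a" (infixr "\<^bold>\<cdot>\<index>" 75)
  where "n \<^bold>\<cdot>\<^bsub>S\<^esub> x \<equiv> x [^]\<^bsub>S\<^esub> n"

abbreviation order_of :: "('a, 'b) ordered_monoid_scheme \<Rightarrow> 'a gorder"
  where "order_of S \<equiv> \<lparr>carrier = carrier S, eq = (=), le = leq S\<rparr>"

definition increasing :: "('a, 'b) ordered_monoid_scheme \<Rightarrow> (nat \<Rightarrow> 'a) \<Rightarrow> bool"
  where "increasing S z \<longleftrightarrow> (\<forall>n. z n \<in> carrier S) \<and> (\<forall>n. z n \<preceq>\<^bsub>S\<^esub> z (Suc n))"

definition is_sup :: "('a, 'b) ordered_monoid_scheme \<Rightarrow> 'a \<Rightarrow> (nat \<Rightarrow> 'a) \<Rightarrow> bool"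
  where "is_sup S s z \<longleftrightarrow> is_lub (order_of S) s (range z)"

definition seq_sup :: "('a, 'b) ordered_monoid_scheme \<Rightarrow> (nat \<Rightarrow> 'a) \<Rightarrow> 'a"
  where "seq_sup S z = \<Squnion>\<^bsub>order_of S\<^esub> (range z)"

definition way_below :: "[('a, 'b) ordered_monoid_scheme, 'a, 'a] \<Rightarrow> bool" (infix "\<lless>\<index>" 50)
  where "x \<lless>\<^bsub>S\<^esub> y \<longleftrightarrow>
    (\<forall>z s. increasing S z \<and> is_sup S s z \<and> y \<preceq>\<^bsub>S\<^esub> s \<longrightarrow> (\<exists>n. x \<preceq>\<^bsub>S\<^esub> z n))"

locale Cu_semigroup = comm_monoid S + partial_order "order_of S"
  for S :: "('a, 'b) ordered_monoid_scheme" (structure) +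
  assumes translation_invariant:
      "\<lbrakk>x \<in> carrier S; y \<in> carrier S; z \<in> carrier S; x \<preceq> y\<rbrakk> \<Longrightarrow> x \<^bold>+ z \<preceq> y \<^bold>+ z"
    and zero_least: "x \<in> carrier S \<Longrightarrow> \<^bold>0 \<preceq> x"
    and O1: "increasing S v \<Longrightarrow> \<exists>s. is_sup S s v"
    and O2: "x \<in> carrier S \<Longrightarrow>
      \<exists>z. (\<forall>n. z n \<in> carrier S) \<and> (\<forall>n. z n \<lless> z (Suc n)) \<and> is_sup S x z"
    and O3: "\<lbrakk>x' \<in> carrier S; x \<in> carrier S; y' \<in> carrier S; y \<in> carrier S; x' \<lless> x; y' \<lless> y\<rbrakk>
      \<Longrightarrow> x' \<^bold>+ y' \<lless> x \<^bold>+ y"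
    and O4: "\<lbrakk>increasing S v; increasing S w\<rbrakk>
      \<Longrightarrow> seq_sup S (\<lambda>n. v n \<^bold>+ w n) = seq_sup S v \<^bold>+ seq_sup S w"

definition infty_mult :: "[('a, 'b) ordered_monoid_scheme, 'a] \<Rightarrow> 'a" ("\<infinity>\<index> _" [76] 75)
  where "\<infinity>\<^bsub>S\<^esub> y = seq_sup S (\<lambda>n. n \<^bold>\<cdot>\<^bsub>S\<^esub> y)"

definition compact_elt :: "('a, 'b) ordered_monoid_scheme \<Rightarrow> 'a \<Rightarrow> bool"
  where "compact_elt S x \<longleftrightarrow> x \<lless>\<^bsub>S\<^esub> x"

definition O5 :: "('a, 'b) ordered_monoid_scheme \<Rightarrow> bool"
  where "O5 S \<longleftrightarrow>
    (\<forall>x'\<in>carrier S. \<forall>x\<in>carrier S. \<forall>y'\<in>carrier S. \<forall>y\<in>carrier S. \<forall>z\<in>carrier S.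
      x' \<lless>\<^bsub>S\<^esub> x \<and> y' \<lless>\<^bsub>S\<^esub> y \<and> x \<^bold>+\<^bsub>S\<^esub> y \<preceq>\<^bsub>S\<^esub> z \<longrightarrow>
      (\<exists>c\<in>carrier S. x' \<^bold>+\<^bsub>S\<^esub> c \<preceq>\<^bsub>S\<^esub> z \<and> z \<preceq>\<^bsub>S\<^esub> x \<^bold>+\<^bsub>S\<^esub> c \<and> y' \<lless>\<^bsub>S\<^esub> c))"

definition Cu_ideal :: "'a set \<Rightarrow> ('a, 'b) ordered_monoid_scheme \<Rightarrow> bool"
  where "Cu_ideal I S \<longleftrightarrow>
    submonoid I S \<and>
    (\<forall>x\<in>carrier S. \<forall>y\<in>I. x \<preceq>\<^bsub>S\<^esub> y \<longrightarrow> x \<in> I) \<and>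
    (\<forall>z s. increasing S z \<and> range z \<subseteq> I \<and> is_sup S s z \<longrightarrow> s \<in> I)"

definition ideal_le :: "('a, 'b) ordered_monoid_scheme \<Rightarrow> 'a set \<Rightarrow> 'a \<Rightarrow> 'a \<Rightarrow> bool"
  where "ideal_le S I x y \<longleftrightarrow> (\<exists>z\<in>I. x \<preceq>\<^bsub>S\<^esub> y \<^bold>+\<^bsub>S\<^esub> z)"

definition ideal_rel :: "('a, 'b) ordered_monoid_scheme \<Rightarrow> 'a set \<Rightarrow> ('a \<times> 'a) set"
  where "ideal_rel S I =
    {(x, y). x \<in> carrier S \<and> y \<in> carrier S \<and> ideal_le S I x y \<and> ideal_le S I y x}"

text \<open>The image \<open>x\<^sub>I\<close> of \<open>x\<close> in the quotient.\<close>

definition quot_class :: "('a, 'b) ordered_monoid_scheme \<Rightarrow> 'a set \<Rightarrow> 'a \<Rightarrow> 'a set"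
  where "quot_class S I x = ideal_rel S I `` {x}"

text \<open>
  For an ideal of a Cu-semigroup the operations below do not depend on representatives: the union
  defining the sum is over copies of one class.
\<close>

definition quotient_Cu :: "('a, 'b) ordered_monoid_scheme \<Rightarrow> 'a set \<Rightarrow> 'a set ordered_monoid"
  where "quotient_Cu S I =
    \<lparr>carrier = carrier S // ideal_rel S I,
     mult = (\<lambda>A B. \<Union>a\<in>A. \<Union>b\<in>B. quot_class S I (a \<^bold>+\<^bsub>S\<^esub> b)),
     one = quot_class S I \<^bold>0\<^bsub>S\<^esub>,
     leq = (\<lambda>A B. \<exists>a\<in>A. \<exists>b\<in>B. ideal_le S I a b)\<rparr>"

definition strongly_soft :: "('a, 'b) ordered_monoid_scheme \<Rightarrow> 'a \<Rightarrow> bool"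
  where "strongly_soft S x \<longleftrightarrow>
    (\<forall>x'\<in>carrier S. x' \<lless>\<^bsub>S\<^esub> x \<longrightarrow>
      (\<exists>t\<in>carrier S. x' \<^bold>+\<^bsub>S\<^esub> t \<lless>\<^bsub>S\<^esub> x \<and> x' \<lless>\<^bsub>S\<^esub> \<infinity>\<^bsub>S\<^esub> t))"

definition weakly_soft :: "('a, 'b) ordered_monoid_scheme \<Rightarrow> 'a \<Rightarrow> bool"
  where "weakly_soft S x \<longleftrightarrow>
    (\<forall>x'\<in>carrier S. x' \<lless>\<^bsub>S\<^esub> x \<longrightarrow>
      (\<exists>n::nat. n \<ge> 1 \<and> (\<exists>t. (\<forall>j\<in>{1..n}. t j \<in> carrier S) \<and>
        (\<forall>j\<in>{1..n}. x' \<^bold>+\<^bsub>S\<^esub> t j \<lless>\<^bsub>S\<^esub> x) \<and> x' \<lless>\<^bsub>S\<^esub> finprod S t {1..n})))"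

definition functionally_soft :: "('a, 'b) ordered_monoid_scheme \<Rightarrow> 'a \<Rightarrow> bool"
  where "functionally_soft S x \<longleftrightarrow>
    (\<forall>x'\<in>carrier S. x' \<lless>\<^bsub>S\<^esub> x \<longrightarrow> (\<exists>n::nat. n \<ge> 1 \<and> (n + 1) \<^bold>\<cdot>\<^bsub>S\<^esub> x' \<lless>\<^bsub>S\<^esub> n \<^bold>\<cdot>\<^bsub>S\<^esub> x))"

definition purely_noncompact :: "('a, 'b) ordered_monoid_scheme \<Rightarrow> 'a \<Rightarrow> bool"
  where "purely_noncompact S x \<longleftrightarrow>
    (\<forall>I. Cu_ideal I S \<and> compact_elt (quotient_Cu S I) (quot_class S I x) \<longrightarrow>
      2 \<^bold>\<cdot>\<^bsub>quotient_Cu S I\<^esub> quot_class S I x = quot_class S I x)"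

definition weakly_purely_noncompact :: "('a, 'b) ordered_monoid_scheme \<Rightarrow> 'a \<Rightarrow> bool"
  where "weakly_purely_noncompact S x \<longleftrightarrow>
    (\<forall>I. Cu_ideal I S \<and> compact_elt (quotient_Cu S I) (quot_class S I x) \<longrightarrow>
      (\<exists>n::nat. (n + 1) \<^bold>\<cdot>\<^bsub>quotient_Cu S I\<^esub> quot_class S I x =
        n \<^bold>\<cdot>\<^bsub>quotient_Cu S I\<^esub> quot_class S I x))"

definition stably_finite :: "('a, 'b) ordered_monoid_scheme \<Rightarrow> bool"
  where "stably_finite S \<longleftrightarrow>
    (\<forall>x\<in>carrier S. \<forall>y\<in>carrier S. x \<^bold>+\<^bsub>S\<^esub> y \<lless>\<^bsub>S\<^esub> x \<longrightarrow> y = \<^bold>0\<^bsub>S\<^esub>)"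

definition residually_stably_finite :: "('a, 'b) ordered_monoid_scheme \<Rightarrow> bool"
  where "residually_stably_finite S \<longleftrightarrow> (\<forall>I. Cu_ideal I S \<longrightarrow> stably_finite (quotient_Cu S I))"

end

theory Submission
  imports Defs
begin

text \<open>
  The image \<open>x\<^sub>I\<close> is compact iff \<open>x \<le>\<^sub>I x'\<close> for some \<open>x' \<lless> x\<close>, which turns every condition
  on the quotient into an inequality in \<open>S\<close>.  For (d), given \<open>x' \<lless> x'' \<lless> x\<close>, (O5) yields an almost
  complement \<open>c\<close> with \<open>x' + c \<le> x \<le> x'' + c\<close>, so that \<open>x\<close> becomes compact modulo the ideal
  generated by \<open>c\<close>.  Hence \<open>(n+1)x'' \<le> nx + mc\<close> for some \<open>m\<close> and \<open>n\<close>, and adding \<open>mx'\<close> on both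
  sides gives \<open>(n+m+1)x' \<le> (n+m)x\<close>.  For (e), stable finiteness of the quotient by the same ideal
  forces \<open>x \<le> \<infinity>c\<close>, and an element \<open>t \<lless> c\<close> close to \<open>c\<close> witnesses strong softness.
\<close>

text \<open>\<open>Upper\<close> only tests those members of a set that lie in the carrier, so the
  terms have to lie there for this reading of \<open>is_lub\<close> to be correct.\<close>

lemma is_sup_iff:
  assumes "\<And>n. z n \<in> carrier S"
  shows "is_sup S s z \<longleftrightarrow> s \<in> carrier S \<and> (\<forall>n. z n \<preceq>\<^bsub>S\<^esub> s) \<and>
    (\<forall>u\<in>carrier S. (\<forall>n. z n \<preceq>\<^bsub>S\<^esub> u) \<longrightarrow> s \<preceq>\<^bsub>S\<^esub> u)"
  using assms by (auto simp: is_sup_def least_def Upper_def)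

lemma is_sup_closed: "is_sup S s z \<Longrightarrow> s \<in> carrier S"
  by (auto simp: is_sup_def least_def Upper_def)

lemma increasing_closed: "increasing S z \<Longrightarrow> z n \<in> carrier S"
  by (simp add: increasing_def)

lemma way_belowE:
  assumes "x \<lless>\<^bsub>S\<^esub> y" "increasing S z" "is_sup S s z" "y \<preceq>\<^bsub>S\<^esub> s"
  obtains n where "x \<preceq>\<^bsub>S\<^esub> z n"
  using assms unfolding way_below_def by blast

section \<open>Cu-semigroups\<close>

context Cu_semigroup
begin

section \<open>Order and addition\<close>

lemma leq_refl: "x \<in> carrier S \<Longrightarrow> x \<preceq> x"
  using le_refl[of x] by simp

lemma leq_trans:
  "\<lbrakk>x \<preceq> y; y \<preceq> z; x \<in> carrier S; y \<in> carrier S; z \<in> carrier S\<rbrakk> \<Longrightarrow> x \<preceq> z"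
  using le_trans[of x y z] by simp

lemma leq_antisym: "\<lbrakk>x \<preceq> y; y \<preceq> x; x \<in> carrier S; y \<in> carrier S\<rbrakk> \<Longrightarrow> x = y"
  using weak_le_antisym[of x y] by simp

lemma add_right_mono:
  "\<lbrakk>x \<preceq> y; x \<in> carrier S; y \<in> carrier S; z \<in> carrier S\<rbrakk> \<Longrightarrow> x \<^bold>+ z \<preceq> y \<^bold>+ z"
  by (rule translation_invariant)

lemma add_left_mono:
  "\<lbrakk>x \<preceq> y; x \<in> carrier S; y \<in> carrier S; z \<in> carrier S\<rbrakk> \<Longrightarrow> z \<^bold>+ x \<preceq> z \<^bold>+ y"
  using add_right_mono[of x y z] by (simp add: m_comm)

lemma add_mono:
  assumes "a \<preceq> b" "c \<preceq> d"
    and [simp]: "a \<in> carrier S" "b \<in> carrier S" "c \<in> carrier S" "d \<in> carrier S"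
  shows "a \<^bold>+ c \<preceq> b \<^bold>+ d"
  by (rule leq_trans[of _ "b \<^bold>+ c"]) (simp_all add: assms add_right_mono add_left_mono)

lemma leq_add_right: "\<lbrakk>x \<in> carrier S; y \<in> carrier S\<rbrakk> \<Longrightarrow> x \<preceq> x \<^bold>+ y"
  using add_left_mono[of "\<^bold>0" y x] zero_least by simp

lemma leq_add_left: "\<lbrakk>x \<in> carrier S; y \<in> carrier S\<rbrakk> \<Longrightarrow> x \<preceq> y \<^bold>+ x"
  using leq_add_right m_comm by metis

lemma nat_mult_mono:
  assumes "x \<preceq> y" "x \<in> carrier S" "y \<in> carrier S"
  shows "(n::nat) \<^bold>\<cdot> x \<preceq> n \<^bold>\<cdot> y"
  using assms by (induction n) (auto intro: add_mono leq_refl)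

section \<open>Suprema of increasing sequences\<close>

lemma is_sup_unique: "\<lbrakk>is_sup S s z; is_sup S t z; increasing S z\<rbrakk> \<Longrightarrow> s = t"
  by (rule leq_antisym) (simp_all add: is_sup_iff increasing_closed)

text \<open>The supremum operator of the library is a choice; antisymmetry leaves only one
  candidate.\<close>

lemma seq_sup_eq: "\<lbrakk>is_sup S s z; increasing S z\<rbrakk> \<Longrightarrow> seq_sup S z = s"
  unfolding seq_sup_def sup_def
  by (rule some_equality) (auto simp flip: is_sup_def dest: is_sup_unique)

lemma is_sup_seq_sup: "increasing S z \<Longrightarrow> is_sup S (seq_sup S z) z"
  using O1 seq_sup_eq by metis

lemma increasing_const: "x \<in> carrier S \<Longrightarrow> increasing S (\<lambda>_. x)"
  by (simp add: increasing_def leq_refl)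

lemma is_sup_const: "x \<in> carrier S \<Longrightarrow> is_sup S x (\<lambda>_. x)"
  by (simp add: is_sup_iff leq_refl)

lemma increasing_add:
  "\<lbrakk>increasing S v; increasing S w\<rbrakk> \<Longrightarrow> increasing S (\<lambda>n. v n \<^bold>+ w n)"
  by (simp add: increasing_def add_mono)

text \<open>This is (O4) as a statement about \<open>is_sup\<close>, so that later arguments can
  name the suprema directly.\<close>

lemma is_sup_add:
  "\<lbrakk>increasing S v; increasing S w; is_sup S s v; is_sup S t w\<rbrakk>
    \<Longrightarrow> is_sup S (s \<^bold>+ t) (\<lambda>n. v n \<^bold>+ w n)"
  using O4[of v w] is_sup_seq_sup[OF increasing_add, of v w] by (simp add: seq_sup_eq)

lemma increasing_nat_mult:
  "increasing S v \<Longrightarrow> increasing S (\<lambda>k. (n::nat) \<^bold>\<cdot> v k)"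
  by (simp add: increasing_def nat_mult_mono)

lemma is_sup_nat_mult:
  assumes "increasing S v" "is_sup S s v"
  shows "is_sup S ((n::nat) \<^bold>\<cdot> s) (\<lambda>k. n \<^bold>\<cdot> v k)"
  using assms by (induction n) (simp_all add: is_sup_const is_sup_add increasing_nat_mult)

lemma increasing_multiples: "y \<in> carrier S \<Longrightarrow> increasing S (\<lambda>n::nat. n \<^bold>\<cdot> y)"
  by (simp add: increasing_def leq_add_right)

lemma is_sup_infty_mult: "y \<in> carrier S \<Longrightarrow> is_sup S (\<infinity> y) (\<lambda>n::nat. n \<^bold>\<cdot> y)"
  unfolding infty_mult_def by (intro is_sup_seq_sup increasing_multiples)

lemma infty_mult_closed [simp]: "y \<in> carrier S \<Longrightarrow> \<infinity> y \<in> carrier S"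
  using is_sup_infty_mult is_sup_closed by metis

lemma nat_mult_leq_infty_mult: "y \<in> carrier S \<Longrightarrow> (n::nat) \<^bold>\<cdot> y \<preceq> \<infinity> y"
  using is_sup_infty_mult[of y] by (simp add: is_sup_iff)

text \<open>By (O4) the left side is the supremum of the multiples \<open>2n y\<close>, each of
  which lies below \<open>\<infinity> y\<close>. This is what makes
  \<open>{y. y \<preceq> \<infinity> c}\<close> closed under addition.\<close>

lemma infty_mult_add_leq:
  assumes [simp]: "y \<in> carrier S"
  shows "\<infinity> y \<^bold>+ \<infinity> y \<preceq> \<infinity> y"
proof -
  have "is_sup S (\<infinity> y \<^bold>+ \<infinity> y) (\<lambda>n::nat. n \<^bold>\<cdot> y \<^bold>+ n \<^bold>\<cdot> y)"
    by (intro is_sup_add increasing_multiples is_sup_infty_mult) simp_all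
  then show ?thesis
    by (simp add: is_sup_iff nat_pow_mult nat_mult_leq_infty_mult)
qed

section \<open>The way-below relation\<close>

lemma way_below_imp_leq: "\<lbrakk>x \<lless> y; y \<in> carrier S\<rbrakk> \<Longrightarrow> x \<preceq> y"
  by (elim way_belowE[OF _ increasing_const is_sup_const]) (simp_all add: leq_refl)

lemma leq_way_below_trans:
  assumes "x \<preceq> y" "y \<lless> z" "x \<in> carrier S" "y \<in> carrier S"
  shows "x \<lless> z"
  unfolding way_below_def
proof (intro allI impI, elim conjE)
  fix v s assume v: "increasing S v" "is_sup S s v" "z \<preceq> s"
  then obtain n where "y \<preceq> v n" using \<open>y \<lless> z\<close> by (elim way_belowE)
  then show "\<exists>n. x \<preceq> v n"
    using assms v(1) by (meson increasing_closed leq_trans)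
qed

lemma way_below_leq_trans:
  assumes "x \<lless> y" "y \<preceq> z" "y \<in> carrier S" "z \<in> carrier S"
  shows "x \<lless> z"
  using assms unfolding way_below_def by (meson is_sup_closed leq_trans)

lemma zero_way_below: "\<^bold>0 \<lless> y"
  unfolding way_below_def by (meson increasing_closed zero_least)

lemma way_below_increasing:
  "\<lbrakk>\<And>n. z n \<in> carrier S; \<And>n. z n \<lless> z (Suc n)\<rbrakk> \<Longrightarrow> increasing S z"
  by (simp add: increasing_def way_below_imp_leq)

text \<open>The sequence from (O2) also satisfies \<open>z n \<lless> x\<close>, because
  \<open>z n \<lless> z (Suc n) \<preceq> x\<close>.\<close>

lemma way_below_seqE:
  assumes "x \<in> carrier S"
  obtains z where "\<And>n. z n \<in> carrier S" "\<And>n. z n \<lless> z (Suc n)" "\<And>n. z n \<lless> x"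
    "is_sup S x z" "increasing S z"
proof -
  obtain z where z: "\<And>n. z n \<in> carrier S" "\<And>n. z n \<lless> z (Suc n)" "is_sup S x z"
    using O2[OF assms] by blast
  then have "z n \<lless> x" for n
    using way_below_leq_trans[of "z n" "z (Suc n)" x] assms by (simp add: is_sup_iff)
  then show thesis using that z way_below_increasing by blast
qed

text \<open>A sequence from (O2) for \<open>y\<close> passes \<open>x\<close> at some index
  \<open>n\<close>, and the next term \<open>z (Suc n)\<close> then lies strictly between in the
  sense of \<open>\<lless>\<close>.\<close>

lemma way_below_interpolate:
  assumes "x \<lless> y" "x \<in> carrier S" "y \<in> carrier S"
  obtains w where "w \<in> carrier S" "x \<lless> w" "w \<lless> y"
proof -
  obtain z where z: "\<And>n. z n \<in> carrier S" "\<And>n. z n \<lless> z (Suc n)" "\<And>n. z n \<lless> y"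
    "is_sup S y z" "increasing S z"
    using way_below_seqE[OF assms(3)] by metis
  obtain n where "x \<preceq> z n"
    using way_belowE[OF assms(1) z(5,4)] assms leq_refl by blast
  then have "x \<lless> z (Suc n)" using z assms leq_way_below_trans by blast
  then show thesis using that z by blast
qed

lemma nat_mult_way_below:
  assumes "x \<lless> y" "x \<in> carrier S" "y \<in> carrier S"
  shows "(n::nat) \<^bold>\<cdot> x \<lless> n \<^bold>\<cdot> y"
  using assms by (induction n) (auto intro: O3 zero_way_below)

section \<open>Finite sums and multiples\<close>

lemma finprod_Suc_interval:
  assumes "\<And>j. j \<in> {1..Suc n} \<Longrightarrow> t j \<in> carrier S"
  shows "finprod S t {1..Suc n} = t (Suc n) \<^bold>+ finprod S t {1..n}"
  using assms by (subst atLeastAtMostSuc_conv) (auto intro!: finprod_insert)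

text \<open>The \<open>n\<close> relations \<open>x' + t j \<lless> x\<close> are added up by
  (O3).\<close>

lemma sum_way_below:
  assumes "\<And>j. j \<in> {1..n} \<Longrightarrow> t j \<in> carrier S" "\<And>j. j \<in> {1..n} \<Longrightarrow> x' \<^bold>+ t j \<lless> x"
    and [simp]: "x' \<in> carrier S" "x \<in> carrier S"
  shows "(n::nat) \<^bold>\<cdot> x' \<^bold>+ finprod S t {1..n} \<lless> n \<^bold>\<cdot> x"
  using assms(1,2)
proof (induction n)
  case 0
  show ?case by (simp add: zero_way_below)
next
  case (Suc n)
  have c [simp]: "finprod S t {1..n} \<in> carrier S" "t (Suc n) \<in> carrier S"
    using Suc.prems by auto
  have eq: "finprod S t {1..Suc n} = t (Suc n) \<^bold>+ finprod S t {1..n}"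
    using Suc.prems by (intro finprod_Suc_interval) auto
  have "(n \<^bold>\<cdot> x' \<^bold>+ finprod S t {1..n}) \<^bold>+ (x' \<^bold>+ t (Suc n)) \<lless> n \<^bold>\<cdot> x \<^bold>+ x"
    using Suc by (intro O3) auto
  then show ?case unfolding eq by (simp add: m_ac del: One_nat_def)
qed

text \<open>Each summand \<open>t j\<close> is absorbed by \<open>x\<close> at the cost of one copy
  of \<open>z\<close>. With \<open>z\<close> in an ideal, this says that \<open>x\<close> absorbs
  the whole sum modulo that ideal.\<close>

lemma sum_absorb:
  assumes "\<And>j. j \<in> {1..n} \<Longrightarrow> t j \<in> carrier S" "\<And>j. j \<in> {1..n} \<Longrightarrow> x \<^bold>+ t j \<preceq> x \<^bold>+ z"
    and [simp]: "x \<in> carrier S" "z \<in> carrier S"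
  shows "x \<^bold>+ finprod S t {1..n} \<preceq> x \<^bold>+ (n::nat) \<^bold>\<cdot> z"
  using assms(1,2)
proof (induction n)
  case 0
  show ?case by (simp add: leq_refl)
next
  case (Suc n)
  have c [simp]: "finprod S t {1..n} \<in> carrier S" "t (Suc n) \<in> carrier S"
    using Suc.prems by auto
  have eq: "finprod S t {1..Suc n} = t (Suc n) \<^bold>+ finprod S t {1..n}"
    using Suc.prems by (intro finprod_Suc_interval) auto
  have "(x \<^bold>+ t (Suc n)) \<^bold>+ finprod S t {1..n} \<preceq> (x \<^bold>+ z) \<^bold>+ finprod S t {1..n}"
    using Suc.prems by (intro add_right_mono) auto
  also have "(x \<^bold>+ z) \<^bold>+ finprod S t {1..n} = (x \<^bold>+ finprod S t {1..n}) \<^bold>+ z"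
    by (simp add: m_ac del: One_nat_def)
  finally have 1: "x \<^bold>+ finprod S t {1..Suc n} \<preceq> (x \<^bold>+ finprod S t {1..n}) \<^bold>+ z"
    unfolding eq by (simp add: m_assoc del: One_nat_def)
  have "(x \<^bold>+ finprod S t {1..n}) \<^bold>+ z \<preceq> (x \<^bold>+ n \<^bold>\<cdot> z) \<^bold>+ z"
    using Suc by (intro add_right_mono) auto
  with 1 have "x \<^bold>+ finprod S t {1..Suc n} \<preceq> (x \<^bold>+ n \<^bold>\<cdot> z) \<^bold>+ z"
    by (rule leq_trans) (simp_all add: eq del: One_nat_def)
  then show ?case by (simp add: m_assoc)
qed

lemma way_below_nat_multE:
  assumes "x' \<lless> x" "x \<preceq> \<infinity> c" "x \<in> carrier S" "c \<in> carrier S"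
  obtains m :: nat where "x' \<preceq> m \<^bold>\<cdot> c"
  by (rule way_belowE[OF assms(1) increasing_multiples is_sup_infty_mult assms(2)])
    (simp_all add: assms that)

text \<open>This set is the ideal generated by \<open>c\<close>. Closure under addition comes from
  \<open>infty_mult_add_leq\<close>; the other closure properties come from transitivity and the
  least upper bound property.\<close>

lemma Cu_ideal_generated:
  assumes [simp]: "c \<in> carrier S"
  shows "Cu_ideal {y \<in> carrier S. y \<preceq> \<infinity> c} S"
  unfolding Cu_ideal_def
proof (intro conjI ballI allI impI)
  show "submonoid {y \<in> carrier S. y \<preceq> \<infinity> c} S"
  proof
    fix x y assume "x \<in> {y \<in> carrier S. y \<preceq> \<infinity> c}" "y \<in> {y \<in> carrier S. y \<preceq> \<infinity> c}"
    then have [simp]: "x \<in> carrier S" "y \<in> carrier S" and le: "x \<preceq> \<infinity> c" "y \<preceq> \<infinity> c" by auto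
    have "x \<^bold>+ y \<preceq> \<infinity> c"
      by (rule leq_trans[OF add_mono[OF le] infty_mult_add_leq]) simp_all
    then show "x \<^bold>+ y \<in> {y \<in> carrier S. y \<preceq> \<infinity> c}" by simp
  qed (auto simp: zero_least)
next
  fix x y assume "x \<in> carrier S" "y \<in> {y \<in> carrier S. y \<preceq> \<infinity> c}" "x \<preceq> y"
  then show "x \<in> {y \<in> carrier S. y \<preceq> \<infinity> c}" using leq_trans[of x y "\<infinity> c"] by simp
next
  fix z s assume *: "increasing S z \<and> range z \<subseteq> {y \<in> carrier S. y \<preceq> \<infinity> c} \<and> is_sup S s z"
  then show "s \<in> {y \<in> carrier S. y \<preceq> \<infinity> c}"
    by (auto simp: is_sup_iff increasing_closed image_subset_iff)
qed

end

section \<open>Quotients by ideals\<close>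

locale Cu_semigroup_ideal = Cu_semigroup +
  fixes I
  assumes ideal: "Cu_ideal I S"
begin

abbreviation qle (infix "\<lesssim>" 50) where "x \<lesssim> y \<equiv> ideal_le S I x y"
abbreviation cls where "cls \<equiv> quot_class S I"
abbreviation Q where "Q \<equiv> quotient_Cu S I"

section \<open>Elements of an ideal\<close>

lemma ideal_submonoid: "submonoid I S"
  using ideal by (simp add: Cu_ideal_def)

lemma ideal_closed [simp]: "z \<in> I \<Longrightarrow> z \<in> carrier S"
  by (rule submonoid.mem_carrier[OF ideal_submonoid])

lemma ideal_zero [simp]: "\<^bold>0 \<in> I"
  by (rule submonoid.one_closed[OF ideal_submonoid])

lemma ideal_add [simp]: "\<lbrakk>x \<in> I; y \<in> I\<rbrakk> \<Longrightarrow> x \<^bold>+ y \<in> I"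
  by (rule submonoid.m_closed[OF ideal_submonoid])

lemma ideal_nat_mult [simp]: "x \<in> I \<Longrightarrow> (n::nat) \<^bold>\<cdot> x \<in> I"
  by (induction n) auto

lemma ideal_sup: "\<lbrakk>increasing S z; \<And>n. z n \<in> I; is_sup S s z\<rbrakk> \<Longrightarrow> s \<in> I"
  using ideal unfolding Cu_ideal_def by blast

lemma ideal_infty_mult: "x \<in> I \<Longrightarrow> \<infinity> x \<in> I"
  by (rule ideal_sup[OF increasing_multiples _ is_sup_infty_mult]) auto

text \<open>Inequalities modulo \<open>I\<close> along a sequence carry a separate error for each
  index; a single bound \<open>e\<close> replaces them all. If \<open>s\<close> is the supremum of
  the partial sums, then \<open>\<infinity> s\<close> bounds every term and absorbs itself.\<close>

lemma ideal_sequence_bound: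
  assumes w: "\<And>n. w n \<in> I"
  obtains e where "e \<in> I" "\<And>n::nat. w n \<preceq> e" "e \<^bold>+ e \<preceq> e"
proof -
  \<comment> \<open>\<open>W n\<close> is the sum of the first \<open>n\<close> terms, so
    \<open>w n\<close> first occurs in \<open>W (Suc n)\<close>.\<close>
  define W where "W = rec_nat \<^bold>0 (\<lambda>n u. u \<^bold>+ w n)"
  have W_Suc: "W (Suc n) = W n \<^bold>+ w n" for n by (simp add: W_def)
  have WI: "W n \<in> I" for n by (induction n) (auto simp: W_def w)
  have inc: "increasing S W"
    by (simp add: increasing_def W_Suc WI w leq_add_right)
  then obtain s where s: "is_sup S s W" using O1 by blast
  have sI: "s \<in> I" using ideal_sup inc WI s by blast
  have "w n \<preceq> \<infinity> s" for n
  proof -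
    have "w n \<preceq> W (Suc n)" by (simp add: W_Suc leq_add_left WI w)
    moreover have "W (Suc n) \<preceq> s" using s by (simp add: is_sup_iff WI)
    moreover have "s \<preceq> \<infinity> s"
      using nat_mult_leq_infty_mult[of s 1] sI by simp
    ultimately show ?thesis by (meson WI sI ideal_closed infty_mult_closed leq_trans w)
  qed
  then show thesis
    using that[of "\<infinity> s"] ideal_infty_mult[OF sI] infty_mult_add_leq[of s] sI by auto
qed

section \<open>The preorder modulo the ideal\<close>

lemma qleI: "\<lbrakk>x \<preceq> y \<^bold>+ z; z \<in> I\<rbrakk> \<Longrightarrow> x \<lesssim> y"
  by (auto simp: ideal_le_def)

lemma qleE:
  assumes "x \<lesssim> y"
  obtains z where "z \<in> I" "z \<in> carrier S" "x \<preceq> y \<^bold>+ z"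
  using assms by (auto simp: ideal_le_def)

lemma leq_imp_qle: "\<lbrakk>x \<preceq> y; x \<in> carrier S; y \<in> carrier S\<rbrakk> \<Longrightarrow> x \<lesssim> y"
  by (rule qleI[of _ _ "\<^bold>0"]) simp_all

lemma qle_refl: "x \<in> carrier S \<Longrightarrow> x \<lesssim> x"
  by (simp add: leq_imp_qle leq_refl)

lemma qle_trans:
  assumes "x \<lesssim> y" "y \<lesssim> z"
    and [simp]: "x \<in> carrier S" "y \<in> carrier S" "z \<in> carrier S"
  shows "x \<lesssim> z"
proof -
  obtain a b where a: "a \<in> I" "x \<preceq> y \<^bold>+ a" and b: "b \<in> I" "y \<preceq> z \<^bold>+ b"
    using assms qleE by metis
  have "x \<preceq> (z \<^bold>+ b) \<^bold>+ a"
    using a b by (intro leq_trans[OF a(2) add_right_mono[OF b(2)]]) simp_all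
  then show ?thesis using a b by (intro qleI[of _ _ "b \<^bold>+ a"]) (simp_all add: m_assoc)
qed

lemma qle_add:
  assumes "x \<lesssim> y" "u \<lesssim> v"
    and [simp]: "x \<in> carrier S" "y \<in> carrier S" "u \<in> carrier S" "v \<in> carrier S"
  shows "x \<^bold>+ u \<lesssim> y \<^bold>+ v"
proof -
  obtain a b where a: "a \<in> I" "x \<preceq> y \<^bold>+ a" and b: "b \<in> I" "u \<preceq> v \<^bold>+ b"
    using assms qleE by metis
  have "x \<^bold>+ u \<preceq> (y \<^bold>+ a) \<^bold>+ (v \<^bold>+ b)" using a b by (intro add_mono) simp_all
  also have "(y \<^bold>+ a) \<^bold>+ (v \<^bold>+ b) = (y \<^bold>+ v) \<^bold>+ (a \<^bold>+ b)" using a b by (simp add: m_ac)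
  finally show ?thesis by (rule qleI) (use a b in simp_all)
qed

lemma qle_nat_mult:
  assumes "x \<lesssim> y" "x \<in> carrier S" "y \<in> carrier S"
  shows "(n::nat) \<^bold>\<cdot> x \<lesssim> n \<^bold>\<cdot> y"
  using assms by (induction n) (auto intro: qle_add qle_refl)

section \<open>Classes and the operations on them\<close>

lemma mem_cls_iff: "x \<in> carrier S \<Longrightarrow> y \<in> cls x \<longleftrightarrow> y \<in> carrier S \<and> x \<lesssim> y \<and> y \<lesssim> x"
  by (auto simp: quot_class_def ideal_rel_def)

lemma mem_cls_self: "x \<in> carrier S \<Longrightarrow> x \<in> cls x"
  by (simp add: mem_cls_iff qle_refl)

lemma cls_eq_iff:
  assumes "x \<in> carrier S" "y \<in> carrier S"
  shows "cls x = cls y \<longleftrightarrow> x \<lesssim> y \<and> y \<lesssim> x"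
proof
  assume "cls x = cls y"
  then show "x \<lesssim> y \<and> y \<lesssim> x" using mem_cls_self[OF assms(1)] assms(2) by (simp add: mem_cls_iff)
next
  assume "x \<lesssim> y \<and> y \<lesssim> x"
  then show "cls x = cls y" using assms by (auto simp: mem_cls_iff intro: qle_trans)
qed

lemma carrier_quotient: "carrier Q = cls ` carrier S"
  by (auto simp: quotient_Cu_def quotient_def quot_class_def)

lemma leq_quotient_iff:
  assumes "x \<in> carrier S" "y \<in> carrier S"
  shows "cls x \<preceq>\<^bsub>Q\<^esub> cls y \<longleftrightarrow> x \<lesssim> y"
proof
  assume "cls x \<preceq>\<^bsub>Q\<^esub> cls y"
  then obtain a b where "a \<in> cls x" "b \<in> cls y" "a \<lesssim> b" by (auto simp: quotient_Cu_def)
  then show "x \<lesssim> y" using assms by (meson mem_cls_iff qle_trans)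
next
  assume "x \<lesssim> y"
  then show "cls x \<preceq>\<^bsub>Q\<^esub> cls y" using mem_cls_self assms by (auto simp: quotient_Cu_def)
qed

lemma add_quotient:
  assumes [simp]: "x \<in> carrier S" "y \<in> carrier S"
  shows "cls x \<^bold>+\<^bsub>Q\<^esub> cls y = cls (x \<^bold>+ y)"
proof -
  have eq: "cls (a \<^bold>+ b) = cls (x \<^bold>+ y)" if "a \<in> cls x" "b \<in> cls y" for a b
    using that by (subst cls_eq_iff) (auto simp: mem_cls_iff intro: qle_add)
  then have "(\<Union>a\<in>cls x. \<Union>b\<in>cls y. cls (a \<^bold>+ b)) = (\<Union>a\<in>cls x. \<Union>b\<in>cls y. cls (x \<^bold>+ y))"
    by simp
  \<comment> \<open>Both index sets are nonempty, so the union of the constant family is its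
    value.\<close>
  also have "\<dots> = cls (x \<^bold>+ y)" using mem_cls_self[of x] mem_cls_self[of y] by auto
  finally show ?thesis by (simp add: quotient_Cu_def)
qed

lemma zero_quotient: "\<^bold>0\<^bsub>Q\<^esub> = cls \<^bold>0"
  by (simp add: quotient_Cu_def)

lemma nat_mult_quotient: "x \<in> carrier S \<Longrightarrow> (n::nat) \<^bold>\<cdot>\<^bsub>Q\<^esub> cls x = cls (n \<^bold>\<cdot> x)"
  by (induction n) (simp_all add: zero_quotient add_quotient)

section \<open>Sequences and compactness in the quotient\<close>

lemma increasing_quotient_iff:
  assumes "\<And>n. z n \<in> carrier S"
  shows "increasing Q (\<lambda>n. cls (z n)) \<longleftrightarrow> (\<forall>n. z n \<lesssim> z (Suc n))"
  using assms by (auto simp: increasing_def carrier_quotient leq_quotient_iff)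

text \<open>If \<open>u\<close> bounds the sequence modulo \<open>I\<close>, a common bound
  \<open>e\<close> of the errors gives \<open>z n \<preceq> u + e\<close> for all \<open>n\<close>,
  hence \<open>s \<preceq> u + e\<close>.\<close>

lemma is_sup_quotient:
  assumes inc: "increasing S z" and sup: "is_sup S s z"
  shows "is_sup Q (cls s) (\<lambda>n. cls (z n))"
proof -
  have [simp]: "z n \<in> carrier S" "s \<in> carrier S" for n
    using inc sup by (simp_all add: increasing_closed is_sup_closed)
  have "s \<lesssim> u" if u: "u \<in> carrier S" "\<And>n. z n \<lesssim> u" for u
  proof -
    obtain w where w: "\<And>n. w n \<in> I" "\<And>n. z n \<preceq> u \<^bold>+ w n"
      using u(2) unfolding ideal_le_def by metis
    obtain e where e: "e \<in> I" "\<And>n. w n \<preceq> e" using ideal_sequence_bound[of w] w by metis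
    have "z n \<preceq> u \<^bold>+ e" for n
      using w e u by (intro leq_trans[OF w(2) add_left_mono[OF e(2)]]) simp_all
    then have "s \<preceq> u \<^bold>+ e" using sup u e by (simp add: is_sup_iff)
    then show ?thesis using e by (auto intro: qleI)
  qed
  moreover have "z n \<lesssim> s" for n
    using sup by (intro leq_imp_qle) (simp_all add: is_sup_iff)
  ultimately show ?thesis
    by (subst is_sup_iff) (auto simp: carrier_quotient leq_quotient_iff)
qed

text \<open>Arbitrary representatives \<open>y n\<close> increase only up to errors in
  \<open>I\<close>. Adding an \<open>e\<close> in \<open>I\<close> that dominates all errors leaves
  the classes unchanged, and \<open>e + e \<preceq> e\<close> makes \<open>y n + e\<close>
  increasing in \<open>S\<close>.\<close>

lemma increasing_quotient_lift:
  assumes "increasing Q Z"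
  obtains v where "increasing S v" "Z = (\<lambda>n. cls (v n))"
proof -
  have "\<forall>n. \<exists>y. y \<in> carrier S \<and> Z n = cls y"
    using increasing_closed[OF assms] unfolding carrier_quotient by blast
  then obtain y where y [simp]: "\<And>n. y n \<in> carrier S" and Z: "\<And>n. Z n = cls (y n)" by metis
  have "y n \<lesssim> y (Suc n)" for n
    using assms Z increasing_quotient_iff[of y] by (simp add: increasing_def leq_quotient_iff)
  then obtain w where w: "\<And>n. w n \<in> I" "\<And>n. y n \<preceq> y (Suc n) \<^bold>+ w n"
    unfolding ideal_le_def by metis
  obtain e where e: "e \<in> I" "\<And>n. w n \<preceq> e" "e \<^bold>+ e \<preceq> e"
    using ideal_sequence_bound[of w] w by metis
  have "y n \<^bold>+ e \<preceq> y (Suc n) \<^bold>+ e" for n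
  proof -
    have "y n \<preceq> y (Suc n) \<^bold>+ e"
      using w e by (intro leq_trans[OF w(2) add_left_mono[OF e(2)]]) simp_all
    then have "y n \<^bold>+ e \<preceq> (y (Suc n) \<^bold>+ e) \<^bold>+ e" using e by (intro add_right_mono) simp_all
    also have "(y (Suc n) \<^bold>+ e) \<^bold>+ e = y (Suc n) \<^bold>+ (e \<^bold>+ e)" using e by (simp add: m_assoc)
    finally show ?thesis
      using e by (elim leq_trans[OF _ add_left_mono[OF e(3)]]) simp_all
  qed
  then have "increasing S (\<lambda>n. y n \<^bold>+ e)" using e by (simp add: increasing_def)
  moreover have "Z n = cls (y n \<^bold>+ e)" for n
    using e qleI[of "y n \<^bold>+ e" "y n" e] leq_imp_qle[of "y n" "y n \<^bold>+ e"]
    by (simp add: Z cls_eq_iff leq_add_right leq_refl)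
  ultimately show thesis using that by blast
qed

text \<open>An increasing sequence of classes is lifted to \<open>S\<close>, where
  \<open>y' \<lless> y\<close> can be applied; \<open>y \<lesssim> y'\<close> carries the outcome
  back to \<open>y\<close>.\<close>

lemma compact_quotientI:
  assumes "y' \<lless> y" "y \<lesssim> y'" and [simp]: "y' \<in> carrier S" "y \<in> carrier S"
  shows "compact_elt Q (cls y)"
  unfolding compact_elt_def way_below_def
proof (intro allI impI, elim conjE)
  fix Z A assume Z: "increasing Q Z" "is_sup Q A Z" "cls y \<preceq>\<^bsub>Q\<^esub> A"
  obtain v where v: "increasing S v" and Zv: "Z = (\<lambda>n. cls (v n))"
    using increasing_quotient_lift[OF Z(1)] .
  have [simp]: "v n \<in> carrier S" for n using v by (rule increasing_closed)
  obtain s where s: "is_sup S s v" using O1[OF v] by blast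
  have [simp]: "s \<in> carrier S" using s by (rule is_sup_closed)
  obtain a where [simp]: "a \<in> carrier S" and A: "A = cls a"
    using is_sup_closed[OF Z(2)] by (auto simp: carrier_quotient)
  \<comment> \<open>The class of \<open>s\<close> bounds the sequence \<open>Z\<close>, and
    \<open>A\<close> is its least upper bound.\<close>
  have "A \<preceq>\<^bsub>Q\<^esub> cls s"
    using Z(2) is_sup_quotient[OF v s] unfolding Zv by (simp add: is_sup_iff carrier_quotient)
  then have "y \<lesssim> s"
    using Z(3) qle_trans[of y a s] unfolding A by (simp add: leq_quotient_iff)
  then obtain e where e: "e \<in> I" "e \<in> carrier S" "y \<preceq> s \<^bold>+ e" by (rule qleE)
  \<comment> \<open>The error \<open>e\<close> is moved into the sequence: \<open>s + e\<close> is
    the supremum of \<open>v n + e\<close>.\<close>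
  obtain n where n: "y' \<preceq> v n \<^bold>+ e"
    using way_belowE[OF assms(1) increasing_add[OF v increasing_const]
        is_sup_add[OF v increasing_const s is_sup_const]] e by metis
  have "y \<lesssim> v n" using qle_trans[OF assms(2) qleI[OF n e(1)]] by simp
  then show "\<exists>n. cls y \<preceq>\<^bsub>Q\<^esub> Z n" by (auto simp: Zv leq_quotient_iff)
qed

text \<open>Compactness is tested on the classes of a sequence from (O2) with supremum
  \<open>x\<close>.\<close>

lemma compact_quotientE:
  assumes "compact_elt Q (cls x)" and [simp]: "x \<in> carrier S"
  obtains x' where "x' \<in> carrier S" "x' \<lless> x" "x \<lesssim> x'"
proof -
  obtain z where z: "\<And>n. z n \<in> carrier S" "\<And>n. z n \<lless> x" "is_sup S x z" "increasing S z"
    using way_below_seqE[OF assms(2)] by metis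
  have "increasing Q (\<lambda>n. cls (z n))"
    using z by (subst increasing_quotient_iff) (auto simp: increasing_def leq_imp_qle)
  moreover have "cls x \<preceq>\<^bsub>Q\<^esub> cls x" by (simp add: leq_quotient_iff qle_refl)
  ultimately obtain n where "cls x \<preceq>\<^bsub>Q\<^esub> cls (z n)"
    using way_belowE[of Q "cls x" "cls x"] is_sup_quotient[OF z(4,3)] assms(1)
    unfolding compact_elt_def by metis
  then show thesis using that z by (auto simp: leq_quotient_iff)
qed

lemma compact_quotient_nat_mult:
  assumes "compact_elt Q (cls x)" and [simp]: "x \<in> carrier S"
  shows "compact_elt Q (cls ((n::nat) \<^bold>\<cdot> x))"
proof -
  obtain x' where "x' \<in> carrier S" "x' \<lless> x" "x \<lesssim> x'" using compact_quotientE[OF assms] .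
  then show ?thesis
    by (intro compact_quotientI[of "n \<^bold>\<cdot> x'"]) (simp_all add: nat_mult_way_below qle_nat_mult)
qed

end

section \<open>Softness and pure noncompactness\<close>

context Cu_semigroup
begin

section \<open>Implications valid in every Cu-semigroup\<close>

lemma Cu_semigroup_idealI: "Cu_ideal I S \<Longrightarrow> Cu_semigroup_ideal S I"
  by (intro Cu_semigroup_ideal.intro Cu_semigroup_axioms Cu_semigroup_ideal_axioms.intro)

lemma strongly_soft_imp_weakly_soft:
  assumes "strongly_soft S x"
  shows "weakly_soft S x"
  unfolding weakly_soft_def
proof (intro ballI impI)
  fix x' assume [simp]: "x' \<in> carrier S" and "x' \<lless> x"
  then obtain t where [simp]: "t \<in> carrier S" and t: "x' \<^bold>+ t \<lless> x" "x' \<lless> \<infinity> t"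
    using assms unfolding strongly_soft_def by blast
  \<comment> \<open>Passing to a multiple of \<open>t\<close> only yields \<open>\<preceq>\<close>;
    the room between \<open>x'\<close> and \<open>w\<close> restores
    \<open>\<lless>\<close>.\<close>
  obtain w where w: "w \<in> carrier S" "x' \<lless> w" "w \<lless> \<infinity> t"
    using way_below_interpolate[OF t(2)] by auto
  obtain m :: nat where "w \<preceq> m \<^bold>\<cdot> t"
    using way_below_nat_multE[OF w(3) leq_refl] by auto
  \<comment> \<open>Weak softness asks for at least one summand, and \<open>m\<close> may be
    0.\<close>
  then have "w \<preceq> Suc m \<^bold>\<cdot> t"
    by (rule leq_trans) (simp_all add: w leq_add_right)
  then have "x' \<lless> Suc m \<^bold>\<cdot> t" using w by (intro way_below_leq_trans[OF w(2)]) simp_all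
  moreover have "finprod S (\<lambda>_. t) {1..Suc m} = Suc m \<^bold>\<cdot> t" by (subst finprod_const) auto
  ultimately show "\<exists>n::nat. n \<ge> 1 \<and> (\<exists>t. (\<forall>j\<in>{1..n}. t j \<in> carrier S) \<and>
      (\<forall>j\<in>{1..n}. x' \<^bold>+ t j \<lless> x) \<and> x' \<lless> finprod S t {1..n})"
    using t(1)
    by (intro exI[of _ "Suc m"] exI[of _ "\<lambda>_::nat. t"] conjI) (simp_all del: nat_pow_Suc One_nat_def)
qed

lemma weakly_softE:
  assumes "weakly_soft S x" "x' \<in> carrier S" "x' \<lless> x"
  obtains n t where "(n::nat) \<ge> 1" "\<And>j. j \<in> {1..n} \<Longrightarrow> t j \<in> carrier S"
    "\<And>j. j \<in> {1..n} \<Longrightarrow> x' \<^bold>+ t j \<lless> x" "x' \<lless> finprod S t {1..n}"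
proof -
  obtain n t where "(n::nat) \<ge> 1" "\<forall>j\<in>{1..n}. t j \<in> carrier S"
    "\<forall>j\<in>{1..n}. x' \<^bold>+ t j \<lless> x" "x' \<lless> finprod S t {1..n}"
    using assms unfolding weakly_soft_def by meson
  then show thesis using that[of n t] by metis
qed

text \<open>In \<open>n x' + (t 1 + ... + t n) \<lless> n x\<close> the sum of the
  \<open>t j\<close> is replaced by the smaller element \<open>x'\<close>.\<close>

lemma weakly_soft_imp_functionally_soft:
  assumes "weakly_soft S x" and [simp]: "x \<in> carrier S"
  shows "functionally_soft S x"
  unfolding functionally_soft_def
proof (intro ballI impI)
  fix x' assume [simp]: "x' \<in> carrier S" and "x' \<lless> x"
  then obtain n t where n: "(n::nat) \<ge> 1" and t: "\<And>j. j \<in> {1..n} \<Longrightarrow> t j \<in> carrier S"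
    "\<And>j. j \<in> {1..n} \<Longrightarrow> x' \<^bold>+ t j \<lless> x" "x' \<lless> finprod S t {1..n}"
    using weakly_softE[OF assms(1)] by metis
  have [simp]: "finprod S t {1..n} \<in> carrier S" using t(1) by (intro finprod_closed) auto
  have "n \<^bold>\<cdot> x' \<^bold>+ x' \<preceq> n \<^bold>\<cdot> x' \<^bold>+ finprod S t {1..n}"
    using t(3) by (intro add_left_mono way_below_imp_leq) (simp_all del: One_nat_def)
  moreover have "n \<^bold>\<cdot> x' \<^bold>+ finprod S t {1..n} \<lless> n \<^bold>\<cdot> x"
    using t by (intro sum_way_below) auto
  ultimately have "n \<^bold>\<cdot> x' \<^bold>+ x' \<lless> n \<^bold>\<cdot> x"
    by (rule leq_way_below_trans) (simp_all del: One_nat_def)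
  then have "(n + 1) \<^bold>\<cdot> x' \<lless> n \<^bold>\<cdot> x" by simp
  with n show "\<exists>n\<ge>1. (n + 1) \<^bold>\<cdot> x' \<lless> n \<^bold>\<cdot> x" by blast
qed

text \<open>Modulo \<open>I\<close>, \<open>x\<close> lies below \<open>x'\<close> and therefore
  below the sum of the \<open>t j\<close>, while \<open>x\<close> absorbs every \<open>t j\<close>.
  So \<open>x + x\<close> lies below \<open>x\<close> plus that sum, which lies below
  \<open>x\<close>.\<close>

lemma weakly_soft_imp_purely_noncompact:
  assumes "weakly_soft S x" and [simp]: "x \<in> carrier S"
  shows "purely_noncompact S x"
  unfolding purely_noncompact_def
proof (intro allI impI, elim conjE)
  fix I assume I: "Cu_ideal I S" and compact: "compact_elt (quotient_Cu S I) (quot_class S I x)"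
  interpret Cu_semigroup_ideal S I using I by (rule Cu_semigroup_idealI)
  obtain x' where [simp]: "x' \<in> carrier S" and x': "x' \<lless> x" "ideal_le S I x x'"
    using compact_quotientE[OF compact] by auto
  obtain n t where t: "\<And>j. j \<in> {1..n::nat} \<Longrightarrow> t j \<in> carrier S"
    "\<And>j. j \<in> {1..n} \<Longrightarrow> x' \<^bold>+ t j \<lless> x" "x' \<lless> finprod S t {1..n}"
    using weakly_softE[OF assms(1) _ x'(1)] \<open>x' \<in> carrier S\<close> by metis
  have [simp]: "finprod S t {1..n} \<in> carrier S" using t(1) by (intro finprod_closed) auto
  obtain z where z [simp]: "z \<in> I" and xz: "x \<preceq> x' \<^bold>+ z" using x'(2) by (rule qleE)
  \<comment> \<open>Trading \<open>x\<close> for \<open>x' + z\<close> makes room for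
    \<open>x' + t j \<lless> x\<close>.\<close>
  have "x \<^bold>+ t j \<preceq> x \<^bold>+ z" if j: "j \<in> {1..n}" for j
  proof -
    have [simp]: "t j \<in> carrier S" using t(1) j .
    have "x \<^bold>+ t j \<preceq> (x' \<^bold>+ z) \<^bold>+ t j" by (intro add_right_mono xz) simp_all
    also have "(x' \<^bold>+ z) \<^bold>+ t j = (x' \<^bold>+ t j) \<^bold>+ z" by (simp add: m_ac)
    finally show ?thesis
      by (rule leq_trans[OF _ add_right_mono[OF way_below_imp_leq[OF t(2)[OF j]]]]) simp_all
  qed
  then have "x \<^bold>+ finprod S t {1..n} \<preceq> x \<^bold>+ n \<^bold>\<cdot> z"
    using t(1) by (intro sum_absorb) auto
  then have "ideal_le S I (x \<^bold>+ finprod S t {1..n}) x" by (rule qleI) simp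
  moreover have "ideal_le S I x (finprod S t {1..n})"
    using t(3) by (intro qle_trans[OF x'(2) leq_imp_qle[OF way_below_imp_leq]]) (simp_all del: One_nat_def)
  then have "ideal_le S I (x \<^bold>+ x) (x \<^bold>+ finprod S t {1..n})" by (intro qle_add qle_refl) (simp_all del: One_nat_def)
  ultimately have "ideal_le S I (x \<^bold>+ x) x"
    using qle_trans[of "x \<^bold>+ x" "x \<^bold>+ finprod S t {1..n}" x] by (simp del: One_nat_def)
  moreover have "ideal_le S I x (x \<^bold>+ x)" by (intro leq_imp_qle leq_add_right) simp_all
  ultimately have "cls (2 \<^bold>\<cdot> x) = cls x"
    by (simp add: cls_eq_iff numeral_2_eq_2)
  then show "2 \<^bold>\<cdot>\<^bsub>Q\<^esub> cls x = cls x" by (simp only: nat_mult_quotient assms)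
qed

text \<open>The exponent \<open>n = 1\<close> works.\<close>

lemma purely_noncompact_imp_weakly_purely_noncompact:
  assumes "purely_noncompact S x" and [simp]: "x \<in> carrier S"
  shows "weakly_purely_noncompact S x"
  unfolding weakly_purely_noncompact_def
proof (intro allI impI, elim conjE)
  fix I assume I: "Cu_ideal I S" and compact: "compact_elt (quotient_Cu S I) (quot_class S I x)"
  interpret Cu_semigroup_ideal S I using I by (rule Cu_semigroup_idealI)
  have "2 \<^bold>\<cdot>\<^bsub>Q\<^esub> cls x = cls x"
    using assms(1) I compact unfolding purely_noncompact_def by blast
  moreover have "cls x = (1::nat) \<^bold>\<cdot>\<^bsub>Q\<^esub> cls x" by (subst nat_mult_quotient) simp_all
  ultimately show "\<exists>n. (n + 1) \<^bold>\<cdot>\<^bsub>Q\<^esub> cls x = n \<^bold>\<cdot>\<^bsub>Q\<^esub> cls x"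
    by (intro exI[of _ "1::nat"]) (simp only: one_add_one)
qed

text \<open>Modulo \<open>I\<close>, \<open>(n + 1) x\<close> lies below \<open>(n + 1) x'\<close>,
  which functional softness places below \<open>n x\<close>.\<close>

lemma functionally_soft_imp_weakly_purely_noncompact:
  assumes "functionally_soft S x" and [simp]: "x \<in> carrier S"
  shows "weakly_purely_noncompact S x"
  unfolding weakly_purely_noncompact_def
proof (intro allI impI, elim conjE)
  fix I assume I: "Cu_ideal I S" and compact: "compact_elt (quotient_Cu S I) (quot_class S I x)"
  interpret Cu_semigroup_ideal S I using I by (rule Cu_semigroup_idealI)
  obtain x' where [simp]: "x' \<in> carrier S" and x': "x' \<lless> x" "ideal_le S I x x'"
    using compact_quotientE[OF compact] by auto
  obtain n :: nat where "(n + 1) \<^bold>\<cdot> x' \<lless> n \<^bold>\<cdot> x"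
    using assms(1) x'(1) unfolding functionally_soft_def by auto
  then have "ideal_le S I ((n + 1) \<^bold>\<cdot> x') (n \<^bold>\<cdot> x)" by (intro leq_imp_qle way_below_imp_leq) simp_all
  then have "ideal_le S I ((n + 1) \<^bold>\<cdot> x) (n \<^bold>\<cdot> x)"
    using qle_nat_mult[OF x'(2), of "n + 1"] by (elim qle_trans[rotated]) simp_all
  moreover have "ideal_le S I (n \<^bold>\<cdot> x) ((n + 1) \<^bold>\<cdot> x)" by (simp add: leq_imp_qle leq_add_right)
  ultimately have "cls ((n + 1) \<^bold>\<cdot> x) = cls (n \<^bold>\<cdot> x)" by (subst cls_eq_iff) simp_all
  then show "\<exists>n. (n + 1) \<^bold>\<cdot>\<^bsub>Q\<^esub> cls x = n \<^bold>\<cdot>\<^bsub>Q\<^esub> cls x"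
    by (auto simp only: nat_mult_quotient assms)
qed

section \<open>Implications that use (O5)\<close>

lemma almost_complement:
  assumes "O5 S" "x' \<lless> x''" "x'' \<lless> x"
    and [simp]: "x' \<in> carrier S" "x'' \<in> carrier S" "x \<in> carrier S"
  obtains c where "c \<in> carrier S" "x' \<^bold>+ c \<preceq> x" "x \<preceq> x'' \<^bold>+ c"
proof -
  \<comment> \<open>(O5) is applied with \<open>y\<close> and \<open>y'\<close> both zero.\<close>
  have "x'' \<^bold>+ \<^bold>0 \<preceq> x" using assms by (simp add: way_below_imp_leq)
  then show thesis
    using assms(1)[unfolded O5_def, rule_format, of x' x'' "\<^bold>0" "\<^bold>0" x] assms(2) zero_way_below that
    by auto
qed

lemma compact_modulo_complement:
  assumes "x'' \<lless> x" "x \<preceq> x'' \<^bold>+ c"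
    and [simp]: "x'' \<in> carrier S" "x \<in> carrier S" "c \<in> carrier S"
  defines "I \<equiv> {y \<in> carrier S. y \<preceq> \<infinity> c}"
  shows "compact_elt (quotient_Cu S I) (quot_class S I x)"
proof -
  have cI: "c \<in> I" using nat_mult_leq_infty_mult[of c 1] by (simp add: I_def)
  interpret Cu_semigroup_ideal S I
    unfolding I_def by (intro Cu_semigroup_idealI Cu_ideal_generated) simp
  have "ideal_le S I x x''" using assms(2) cI by (rule qleI)
  with assms(1) show ?thesis by (rule compact_quotientI) simp_all
qed

lemma weakly_purely_noncompact_imp_functionally_soft:
  assumes "O5 S" "weakly_purely_noncompact S x" and [simp]: "x \<in> carrier S"
  shows "functionally_soft S x"
  unfolding functionally_soft_def
proof (intro ballI impI)
  fix u assume [simp]: "u \<in> carrier S" and "u \<lless> x"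
  \<comment> \<open>The complement is taken for \<open>x'\<close> rather than \<open>u\<close>,
    which keeps \<open>u \<lless> x'\<close> in reserve for the final
    \<open>\<lless>\<close>.\<close>
  obtain x' where [simp]: "x' \<in> carrier S" and x': "u \<lless> x'" "x' \<lless> x"
    using way_below_interpolate[OF \<open>u \<lless> x\<close>] by auto
  obtain x'' where [simp]: "x'' \<in> carrier S" and x'': "x' \<lless> x''" "x'' \<lless> x"
    using way_below_interpolate[OF x'(2)] by auto
  obtain c where [simp]: "c \<in> carrier S" and c: "x' \<^bold>+ c \<preceq> x" "x \<preceq> x'' \<^bold>+ c"
    using almost_complement[OF assms(1) x''] by auto
  define I where "I = {y \<in> carrier S. y \<preceq> \<infinity> c}"
  have I: "Cu_ideal I S" unfolding I_def by (rule Cu_ideal_generated) simp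
  have leq_of_mem: "e \<preceq> \<infinity> c" if "e \<in> I" for e using that by (simp add: I_def)
  interpret Cu_semigroup_ideal S I using I by (rule Cu_semigroup_idealI)
  have "compact_elt Q (cls x)"
    using compact_modulo_complement[OF x''(2) c(2)] unfolding I_def by simp
  then obtain n :: nat where "(n + 1) \<^bold>\<cdot>\<^bsub>Q\<^esub> cls x = n \<^bold>\<cdot>\<^bsub>Q\<^esub> cls x"
    using assms(2) I unfolding weakly_purely_noncompact_def by blast
  then have "cls ((n + 1) \<^bold>\<cdot> x) = cls (n \<^bold>\<cdot> x)" by (simp only: nat_mult_quotient assms)
  then have "ideal_le S I ((n + 1) \<^bold>\<cdot> x) (n \<^bold>\<cdot> x)" by (subst (asm) cls_eq_iff) simp_all
  then obtain e where e: "e \<in> I" "e \<in> carrier S" "(n + 1) \<^bold>\<cdot> x \<preceq> n \<^bold>\<cdot> x \<^bold>+ e" by (rule qleE)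
  have "n \<^bold>\<cdot> x \<^bold>+ e \<preceq> n \<^bold>\<cdot> x \<^bold>+ \<infinity> c"
    using e by (intro add_left_mono leq_of_mem) simp_all
  then have le: "(n + 1) \<^bold>\<cdot> x \<preceq> n \<^bold>\<cdot> x \<^bold>+ \<infinity> c"
    using e by (elim leq_trans[OF e(3)]) simp_all
  \<comment> \<open>Shrinking \<open>x\<close> to \<open>x''\<close> on the left allows
    \<open>\<infinity> c\<close> to be replaced by a finite multiple \<open>m c\<close>.\<close>
  have "(n + 1) \<^bold>\<cdot> x'' \<lless> (n + 1) \<^bold>\<cdot> x" using x''(2) by (intro nat_mult_way_below) simp_all
  moreover have "increasing S (\<lambda>m::nat. n \<^bold>\<cdot> x \<^bold>+ m \<^bold>\<cdot> c)"
    "is_sup S (n \<^bold>\<cdot> x \<^bold>+ \<infinity> c) (\<lambda>m::nat. n \<^bold>\<cdot> x \<^bold>+ m \<^bold>\<cdot> c)"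
    by (intro increasing_add is_sup_add increasing_const is_sup_const increasing_multiples
        is_sup_infty_mult; simp)+
  ultimately obtain m :: nat where m: "(n + 1) \<^bold>\<cdot> x'' \<preceq> n \<^bold>\<cdot> x \<^bold>+ m \<^bold>\<cdot> c"
    using le by (elim way_belowE)
  have "(n + 1) \<^bold>\<cdot> x' \<preceq> (n + 1) \<^bold>\<cdot> x''"
    using x''(1) by (intro nat_mult_mono way_below_imp_leq) simp_all
  then have "(n + 1) \<^bold>\<cdot> x' \<preceq> n \<^bold>\<cdot> x \<^bold>+ m \<^bold>\<cdot> c" using m by (rule leq_trans) simp_all
  \<comment> \<open>The added \<open>m x'\<close> pairs with \<open>m c\<close> to form
    \<open>m (x' + c)\<close>, which is at most \<open>m x\<close>.\<close>
  then have "(n + 1) \<^bold>\<cdot> x' \<^bold>+ m \<^bold>\<cdot> x' \<preceq> (n \<^bold>\<cdot> x \<^bold>+ m \<^bold>\<cdot> c) \<^bold>+ m \<^bold>\<cdot> x'"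
    by (rule add_right_mono) simp_all
  also have "(n \<^bold>\<cdot> x \<^bold>+ m \<^bold>\<cdot> c) \<^bold>+ m \<^bold>\<cdot> x' = n \<^bold>\<cdot> x \<^bold>+ m \<^bold>\<cdot> (x' \<^bold>+ c)"
    by (simp add: pow_mult_distrib m_ac)
  finally have "(n + 1) \<^bold>\<cdot> x' \<^bold>+ m \<^bold>\<cdot> x' \<preceq> n \<^bold>\<cdot> x \<^bold>+ m \<^bold>\<cdot> x"
    by (rule leq_trans[OF _ add_left_mono[OF nat_mult_mono[OF c(1)]]]) simp_all
  then have "((n + m) + 1) \<^bold>\<cdot> x' \<preceq> (n + m) \<^bold>\<cdot> x"
    by (simp only: nat_pow_mult \<open>x' \<in> carrier S\<close> assms ac_simps)
  \<comment> \<open>One more copy on each side secures a multiplier of at least 1, as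
    \<open>n\<close> and \<open>m\<close> may both be 0.\<close>
  moreover have "x' \<preceq> x" using x'(2) by (rule way_below_imp_leq) simp
  ultimately have "((n + m + 1) + 1) \<^bold>\<cdot> x' \<preceq> (n + m + 1) \<^bold>\<cdot> x"
    using add_mono[of "((n + m) + 1) \<^bold>\<cdot> x'" "(n + m) \<^bold>\<cdot> x" x' x] by simp
  moreover have "((n + m + 1) + 1) \<^bold>\<cdot> u \<lless> ((n + m + 1) + 1) \<^bold>\<cdot> x'"
    using x'(1) by (intro nat_mult_way_below) simp_all
  ultimately have "((n + m + 1) + 1) \<^bold>\<cdot> u \<lless> (n + m + 1) \<^bold>\<cdot> x"
    by (elim way_below_leq_trans) simp_all
  then show "\<exists>n\<ge>1. (n + 1) \<^bold>\<cdot> u \<lless> n \<^bold>\<cdot> x" by (intro exI[of _ "n + m + 1"]) simp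
qed

lemma weakly_purely_noncompact_imp_strongly_soft:
  assumes "O5 S" "residually_stably_finite S" "weakly_purely_noncompact S x"
    and [simp]: "x \<in> carrier S"
  shows "strongly_soft S x"
  unfolding strongly_soft_def
proof (intro ballI impI)
  fix u assume [simp]: "u \<in> carrier S" and "u \<lless> x"
  obtain x' where [simp]: "x' \<in> carrier S" and x': "u \<lless> x'" "x' \<lless> x"
    using way_below_interpolate[OF \<open>u \<lless> x\<close>] by auto
  obtain x'' where [simp]: "x'' \<in> carrier S" and x'': "x' \<lless> x''" "x'' \<lless> x"
    using way_below_interpolate[OF x'(2)] by auto
  obtain c where [simp]: "c \<in> carrier S" and c: "x' \<^bold>+ c \<preceq> x" "x \<preceq> x'' \<^bold>+ c"
    using almost_complement[OF assms(1) x''] by auto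
  define I where "I = {y \<in> carrier S. y \<preceq> \<infinity> c}"
  have I: "Cu_ideal I S" unfolding I_def by (rule Cu_ideal_generated) simp
  have leq_of_mem: "e \<preceq> \<infinity> c" if "e \<in> I" for e using that by (simp add: I_def)
  interpret Cu_semigroup_ideal S I using I by (rule Cu_semigroup_idealI)
  have compact: "compact_elt Q (cls x)"
    using compact_modulo_complement[OF x''(2) c(2)] unfolding I_def by simp
  then obtain n :: nat where n: "(n + 1) \<^bold>\<cdot>\<^bsub>Q\<^esub> cls x = n \<^bold>\<cdot>\<^bsub>Q\<^esub> cls x"
    using assms(3) I unfolding weakly_purely_noncompact_def by blast
  \<comment> \<open>The compact class of \<open>n x\<close> absorbs the class of \<open>x\<close>,
    so stable finiteness forces the latter to be zero, that is,
    \<open>x \<preceq> \<infinity> c\<close>.\<close>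
  have "cls (n \<^bold>\<cdot> x) \<^bold>+\<^bsub>Q\<^esub> cls x = cls (n \<^bold>\<cdot> x)"
    using n by (simp add: nat_mult_quotient)
  then have "cls (n \<^bold>\<cdot> x) \<^bold>+\<^bsub>Q\<^esub> cls x \<lless>\<^bsub>Q\<^esub> cls (n \<^bold>\<cdot> x)"
    using compact_quotient_nat_mult[OF compact, of n] by (simp add: compact_elt_def)
  moreover have "stably_finite Q" using assms(2) I by (simp add: residually_stably_finite_def)
  ultimately have "cls x = \<^bold>0\<^bsub>Q\<^esub>"
    using nat_pow_closed[OF assms(4), of n] assms(4) unfolding stably_finite_def carrier_quotient by blast
  then have "ideal_le S I x \<^bold>0" by (simp add: zero_quotient cls_eq_iff)
  then obtain e where "e \<in> I" "x \<preceq> \<^bold>0 \<^bold>+ e" by (rule qleE)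
  then have xc: "x \<preceq> \<infinity> c" using leq_trans[of x e "\<infinity> c"] leq_of_mem by simp
  obtain w where [simp]: "w \<in> carrier S" and w: "u \<lless> w" "w \<lless> x'"
    using way_below_interpolate[OF x'(1)] by auto
  obtain m :: nat where m: "x' \<preceq> m \<^bold>\<cdot> c" using way_below_nat_multE[OF x'(2) xc] by auto
  \<comment> \<open>The witness \<open>t\<close> must be way below \<open>c\<close> so that
    \<open>u + t \<lless> x' + c \<preceq> x\<close>. Since
    \<open>w \<lless> x' \<preceq> m c\<close> and \<open>m c\<close> is the supremum of
    \<open>m (z k)\<close>, some \<open>z k\<close> is still large enough.\<close>
  obtain z where z: "\<And>k. z k \<in> carrier S" "\<And>k. z k \<lless> c" "is_sup S c z" "increasing S z"
    using way_below_seqE[OF \<open>c \<in> carrier S\<close>] by metis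
  obtain k where k: "w \<preceq> m \<^bold>\<cdot> z k"
    using way_belowE[OF w(2) increasing_nat_mult[OF z(4)] is_sup_nat_mult[OF z(4,3)] m] .
  have "m \<^bold>\<cdot> z k \<preceq> \<infinity> (z k)" by (rule nat_mult_leq_infty_mult) (rule z)
  then have "u \<lless> \<infinity> (z k)"
    using way_below_leq_trans[OF w(1)] leq_trans[OF k] z(1) by simp
  moreover have "u \<^bold>+ z k \<lless> x"
    using O3[OF _ _ _ _ x'(1) z(2)] z(1) c(1) way_below_leq_trans[of "u \<^bold>+ z k" "x' \<^bold>+ c" x] by simp
  ultimately show "\<exists>t\<in>carrier S. u \<^bold>+ t \<lless> x \<and> u \<lless> \<infinity> t" using z(1) by blast
qed

end

theorem proposition4p5:
  fixes S :: "('a, 'b) ordered_monoid_scheme" and x :: 'a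
  assumes "Cu_semigroup S" and "x \<in> carrier S"
  shows "(strongly_soft S x \<longrightarrow> weakly_soft S x) \<and>
    (weakly_soft S x \<longrightarrow> functionally_soft S x \<and> purely_noncompact S x) \<and>
    (purely_noncompact S x \<or> functionally_soft S x \<longrightarrow> weakly_purely_noncompact S x) \<and>
    (O5 S \<longrightarrow> (functionally_soft S x \<longleftrightarrow> weakly_purely_noncompact S x)) \<and>
    (O5 S \<and> residually_stably_finite S \<longrightarrow>
      (strongly_soft S x \<longleftrightarrow> weakly_soft S x) \<and>
      (weakly_soft S x \<longleftrightarrow> functionally_soft S x) \<and>
      (functionally_soft S x \<longleftrightarrow> purely_noncompact S x) \<and>
      (purely_noncompact S x \<longleftrightarrow> weakly_purely_noncompact S x))"
proof -
  interpret Cu_semigroup S by fact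
  note x = \<open>x \<in> carrier S\<close>
  \<comment> \<open>Under both extra hypotheses the last implication leads from the weakest property
    back to strong softness and closes the cycle.\<close>
  show ?thesis
    using strongly_soft_imp_weakly_soft weakly_soft_imp_functionally_soft[OF _ x]
      weakly_soft_imp_purely_noncompact[OF _ x]
      purely_noncompact_imp_weakly_purely_noncompact[OF _ x]
      functionally_soft_imp_weakly_purely_noncompact[OF _ x]
      weakly_purely_noncompact_imp_functionally_soft[OF _ _ x]
      weakly_purely_noncompact_imp_strongly_soft[OF _ _ _ x]
    by blast
qed

end
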